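(* Let $f:\mathbb{R}^d\to\mathbb{R}$ be a differentiable convex function. For any $t>0$, any initial position $X_0\in\mathbb{R}^d$, and any reference position $z\in\mathbb{R}^d$, the Hamiltonian flow trajectory $(X_\tau,Y_\tau)_{\tau\in[0,t]}$ of $f$ started from $(X_0,\mathbf{0})$ satisfies $$f(X_t)-f(z)\le\frac{2}{3}(f(X_0)-f(z))-\frac{1}{6}\frac{\mathrm{d}^2}{\mathrm{d}t^2}\|X_t-z\|^2.$$
   Context: The Hamiltonian flow of $f$ is the system $\dot X_t=Y_t$, $\dot Y_t=-\nabla f(X_t)$ on $\mathbb{R}^d\times\mathbb{R}^d$. Standing assumptions: $f$ has a unique minimizer, and for every initial condition the Hamiltonian flow admits a unique solution on $[0,\infty)$. *)

theory Defs
  imports "HOL-Analysis.Analysis"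
begin

definition grad :: "('a::real_inner \<Rightarrow> real) \<Rightarrow> 'a \<Rightarrow> 'a" where
  "grad f x = (THE D. GDERIV f x :> D)"

lemma GDERIV_grad:
  fixes f :: "'a::euclidean_space \<Rightarrow> real"
  assumes "f differentiable (at x)"
  shows "GDERIV f x :> grad f x"
proof -
  obtain f' where f': "(f has_derivative f') (at x)"
    using assms by (auto simp: differentiable_def)
  interpret linear f' using f' by (rule has_derivative_linear)
  define D where "D = (\<Sum>b\<in>Basis. f' b *\<^sub>R b)"
  have "f' h = h \<bullet> D" for h
  proof -
    have "f' h = f' (\<Sum>b\<in>Basis. (h \<bullet> b) *\<^sub>R b)" by (simp add: euclidean_representation)
    also have "\<dots> = h \<bullet> D" by (simp add: sum scale D_def inner_sum_right mult.commute)
    finally show ?thesis .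
  qed
  with f' have D: "GDERIV f x :> D" unfolding gderiv_def by (metis (no_types) ext)
  have "D' = D" if "GDERIV f x :> D'" for D'
  proof -
    have "(\<lambda>h. h \<bullet> D') = (\<lambda>h. h \<bullet> D)"
      using that D unfolding gderiv_def by (rule has_derivative_unique)
    then have "(D' - D) \<bullet> D' = (D' - D) \<bullet> D" by meson
    then have "(D' - D) \<bullet> (D' - D) = 0" by (simp add: inner_diff_right)
    then show ?thesis by simp
  qed
  with D show ?thesis unfolding grad_def by (metis (mono_tags, lifting) theI)
qed

text \<open>The derivative at time \<open>0\<close> is the right-hand one; at positive times it is two-sided.\<close>

definition hamiltonian_trajectory ::
  "('a::real_inner \<Rightarrow> real) \<Rightarrow> 'a \<Rightarrow> 'a \<Rightarrow> (real \<Rightarrow> 'a) \<Rightarrow> (real \<Rightarrow> 'a) \<Rightarrow> bool" where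
  "hamiltonian_trajectory f x0 y0 X Y \<longleftrightarrow>
     X 0 = x0 \<and> Y 0 = y0 \<and>
     (\<forall>s\<ge>0. (X has_vector_derivative Y s) (at s within {0..}) \<and>
            (Y has_vector_derivative - grad f (X s)) (at s within {0..}))"

text \<open>Trajectories are total functions on \<open>real\<close>, so uniqueness is asserted on \<open>{0..}\<close> only.\<close>

definition hamiltonian_flow_well_posed :: "('a::real_inner \<Rightarrow> real) \<Rightarrow> bool" where
  "hamiltonian_flow_well_posed f \<longleftrightarrow>
     (\<forall>x0 y0. (\<exists>X Y. hamiltonian_trajectory f x0 y0 X Y) \<and>
       (\<forall>X Y X' Y'. hamiltonian_trajectory f x0 y0 X Y \<longrightarrow> hamiltonian_trajectory f x0 y0 X' Y' \<longrightarrow>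
          (\<forall>s\<ge>0. X s = X' s \<and> Y s = Y' s)))"

end

theory Submission
  imports Defs
begin

text \<open>
  Two facts carry the proof: the Hamiltonian \<open>f X + |Y|\<^sup>2 / 2\<close> is conserved along the flow, and a
  convex function lies above its tangents.  Put \<open>g = grad f (X t)\<close> and write \<open>x\<close>, \<open>y\<close> for the
  position and velocity at time \<open>t\<close>.  Differentiating the squared distance to \<open>z\<close> twice along the
  flow gives

    \<open>2 |y|\<^sup>2 - 2 (x - z) \<bullet> g\<close>,

  and conservation of energy from a start at rest turns \<open>|y|\<^sup>2\<close> into \<open>2 (f X0 - f x)\<close>.  Hence the
  right-hand side of the claim equals \<open>2/3 (f x - f z) + 1/3 (x - z) \<bullet> g\<close>: the dependence on \<open>X0\<close>
  cancels.  The tangent inequality \<open>(x - z) \<bullet> g \<ge> f x - f z\<close> then yields exactly \<open>f x - f z\<close>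
  as a lower bound.
\<close>

text \<open>Restricting \<open>f\<close> to the line through \<open>x\<close> and \<open>z\<close> reduces this to the tangent inequality on the
  real line.\<close>

lemma convex_on_above_gradient_tangent:
  fixes f :: "'a::real_inner \<Rightarrow> real"
  assumes convex: "convex_on UNIV f" and deriv: "GDERIV f x :> g"
  shows "f z - f x \<ge> (z - x) \<bullet> g"
proof -
  define \<phi> where "\<phi> = (\<lambda>s::real. f (x + s *\<^sub>R (z - x)))"
  have "convex_on UNIV \<phi>"
  proof (rule convex_onI)
    fix t a b :: real
    assume t: "0 < t" "t < 1"
    have "x + ((1 - t) *\<^sub>R a + t *\<^sub>R b) *\<^sub>R (z - x)
        = (1 - t) *\<^sub>R (x + a *\<^sub>R (z - x)) + t *\<^sub>R (x + b *\<^sub>R (z - x))"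
      by (simp add: algebra_simps)
    then show "\<phi> ((1 - t) *\<^sub>R a + t *\<^sub>R b) \<le> (1 - t) * \<phi> a + t * \<phi> b"
      using convex_onD[OF convex, of t "x + a *\<^sub>R (z - x)" "x + b *\<^sub>R (z - x)"] t
      by (simp add: \<phi>_def)
  qed simp
  moreover have "(\<phi> has_real_derivative (z - x) \<bullet> g) (at 0)"
  proof -
    have f': "(f has_derivative (\<lambda>h. h \<bullet> g)) (at (x + 0 *\<^sub>R (z - x)))"
      using deriv by (simp add: gderiv_def)
    have "((\<lambda>s. x + s *\<^sub>R (z - x)) has_derivative (\<lambda>s. s *\<^sub>R (z - x))) (at (0::real))"
      by (auto intro!: derivative_eq_intros)
    from has_derivative_compose[OF this f'] show ?thesis
      by (simp add: \<phi>_def has_field_derivative_def mult_commute_abs)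
  qed
  ultimately have "\<phi> 1 - \<phi> 0 \<ge> (z - x) \<bullet> g * (1 - 0)"
    by (intro convex_on_imp_above_tangent[where A = UNIV]) auto
  then show ?thesis by (simp add: \<phi>_def)
qed

lemma hamiltonian_trajectory_at:
  assumes "hamiltonian_trajectory f x0 y0 X Y" and "s > 0"
  shows "(X has_vector_derivative Y s) (at s)"
    and "(Y has_vector_derivative - grad f (X s)) (at s)"
proof -
  have "at s within {0..} = at s"
    using assms(2) by (intro at_within_interior) simp
  with assms show "(X has_vector_derivative Y s) (at s)"
    and "(Y has_vector_derivative - grad f (X s)) (at s)"
    unfolding hamiltonian_trajectory_def by (metis less_imp_le)+
qed

text \<open>The derivative of the energy is \<open>Y \<bullet> grad f X - grad f X \<bullet> Y = 0\<close>.\<close>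

lemma hamiltonian_energy_conserved:
  fixes f :: "'a::euclidean_space \<Rightarrow> real"
  assumes diff: "f differentiable_on UNIV"
    and traj: "hamiltonian_trajectory f x0 y0 X Y" and "s \<ge> 0"
  shows "f (X s) + (Y s \<bullet> Y s) / 2 = f x0 + (y0 \<bullet> y0) / 2"
proof -
  define E where "E = (\<lambda>\<tau>. f (X \<tau>) + (Y \<tau> \<bullet> Y \<tau>) / 2)"
  have "(E has_derivative (\<lambda>h. 0)) (at \<tau> within {0..})" if "\<tau> \<in> {0..}" for \<tau>
  proof -
    have X': "(X has_derivative (\<lambda>h. h *\<^sub>R Y \<tau>)) (at \<tau> within {0..})"
      and Y': "(Y has_derivative (\<lambda>h. h *\<^sub>R - grad f (X \<tau>))) (at \<tau> within {0..})"
      using traj that unfolding hamiltonian_trajectory_def has_vector_derivative_def by auto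
    have "(f has_derivative (\<lambda>h. h \<bullet> grad f (X \<tau>))) (at (X \<tau>))"
      using GDERIV_grad[of f "X \<tau>"] diff
      by (simp add: gderiv_def differentiable_on_eq_differentiable_at)
    from has_derivative_compose[OF X' this]
    have "((\<lambda>\<tau>. f (X \<tau>)) has_derivative (\<lambda>h. h *\<^sub>R Y \<tau> \<bullet> grad f (X \<tau>))) (at \<tau> within {0..})" .
    moreover have "((\<lambda>\<tau>. (Y \<tau> \<bullet> Y \<tau>) / 2) has_derivative (\<lambda>h. - (h *\<^sub>R Y \<tau> \<bullet> grad f (X \<tau>))))
        (at \<tau> within {0..})"
      using has_derivative_mult_right[OF has_derivative_inner[OF Y' Y'], of "1 / 2"]
      by (simp add: inner_commute)
    ultimately show ?thesis
      using has_derivative_add by (fastforce simp: E_def)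
  qed
  from has_derivative_zero_constant[OF _ this]
  obtain c where "\<And>\<tau>. \<tau> \<in> {0..} \<Longrightarrow> E \<tau> = c" by (auto simp: convex_real_interval)
  then have "E s = E 0" using \<open>s \<ge> 0\<close> by simp
  then show ?thesis
    using traj by (simp add: E_def hamiltonian_trajectory_def)
qed

lemma dist_square_has_derivative:
  assumes "hamiltonian_trajectory f x0 y0 X Y" and "s > 0"
  shows "((\<lambda>\<tau>. (norm (X \<tau> - z))\<^sup>2) has_real_derivative 2 * ((X s - z) \<bullet> Y s)) (at s)"
proof -
  have X': "(X has_derivative (\<lambda>h. h *\<^sub>R Y s)) (at s)"
    using hamiltonian_trajectory_at(1)[OF assms] by (simp add: has_vector_derivative_def)
  show ?thesis
    unfolding power2_norm_eq_inner has_field_derivative_def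
    by (rule derivative_eq_intros X' refl)+ (simp add: inner_commute fun_eq_iff algebra_simps)
qed

text \<open>Only on positive times is the first derivative known to be \<open>2 (X - z) \<bullet> Y\<close>; as differentiation
  at \<open>s > 0\<close> is local, this determines the second one.\<close>

lemma dist_square_has_second_derivative:
  assumes traj: "hamiltonian_trajectory f x0 y0 X Y" and "s > 0"
  shows "(deriv (\<lambda>\<tau>. (norm (X \<tau> - z))\<^sup>2) has_real_derivative
           2 * (Y s \<bullet> Y s) - 2 * ((X s - z) \<bullet> grad f (X s))) (at s)"
proof -
  have X': "(X has_derivative (\<lambda>h. h *\<^sub>R Y s)) (at s)"
    and Y': "(Y has_derivative (\<lambda>h. h *\<^sub>R - grad f (X s))) (at s)"
    using hamiltonian_trajectory_at[OF assms] by (simp_all add: has_vector_derivative_def)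
  have "((\<lambda>\<tau>. 2 * ((X \<tau> - z) \<bullet> Y \<tau>)) has_real_derivative
           2 * (Y s \<bullet> Y s) - 2 * ((X s - z) \<bullet> grad f (X s))) (at s)"
    unfolding has_field_derivative_def
    by (rule derivative_eq_intros X' Y' refl)+ (simp add: fun_eq_iff algebra_simps)
  moreover have "2 * ((X \<tau> - z) \<bullet> Y \<tau>) = deriv (\<lambda>\<tau>. (norm (X \<tau> - z))\<^sup>2) \<tau>"
    if "\<tau> \<in> {0<..}" for \<tau>
    using DERIV_imp_deriv[OF dist_square_has_derivative[OF traj]] that by simp
  ultimately show ?thesis
    using has_field_derivative_transform_within_open[of _ _ s "{0<..}"] \<open>s > 0\<close> by simp
qed

theorem lemma2:
  fixes f :: "real ^ 'd \<Rightarrow> real"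
    and X Y :: "real \<Rightarrow> real ^ 'd"
    and X0 z :: "real ^ 'd"
    and t :: real
  assumes "f differentiable_on UNIV"
    and "convex_on UNIV f"
    and "\<exists>!x. \<forall>y. f x \<le> f y"
    and "hamiltonian_flow_well_posed f"
    and "t > 0"
    and "hamiltonian_trajectory f X0 0 X Y"
  shows "(\<forall>s>0. (\<lambda>\<tau>. (norm (X \<tau> - z))\<^sup>2) differentiable (at s))
    \<and> deriv (\<lambda>\<tau>. (norm (X \<tau> - z))\<^sup>2) differentiable (at t)
    \<and> f (X t) - f z \<le> 2 / 3 * (f X0 - f z)
           - 1 / 6 * (deriv ^^ 2) (\<lambda>\<tau>. (norm (X \<tau> - z))\<^sup>2) t"
proof (intro conjI)
  note second = dist_square_has_second_derivative[OF assms(6,5), of z]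
  show "\<forall>s>0. (\<lambda>\<tau>. (norm (X \<tau> - z))\<^sup>2) differentiable (at s)"
    using dist_square_has_derivative[OF assms(6)] real_differentiable_def by blast
  show "deriv (\<lambda>\<tau>. (norm (X \<tau> - z))\<^sup>2) differentiable (at t)"
    using second real_differentiable_def by blast
  have "(deriv ^^ 2) (\<lambda>\<tau>. (norm (X \<tau> - z))\<^sup>2) t
      = 2 * (Y t \<bullet> Y t) - 2 * ((X t - z) \<bullet> grad f (X t))"
    using DERIV_imp_deriv[OF second] by (simp add: numeral_2_eq_2)
  then have "2 / 3 * (f X0 - f z) - 1 / 6 * (deriv ^^ 2) (\<lambda>\<tau>. (norm (X \<tau> - z))\<^sup>2) t
      = 2 / 3 * (f X0 - f z) - 1 / 3 * (Y t \<bullet> Y t) + 1 / 3 * ((X t - z) \<bullet> grad f (X t))"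
    by (simp add: field_simps)
  moreover have "f (X t) + (Y t \<bullet> Y t) / 2 = f X0"
    using hamiltonian_energy_conserved[OF assms(1,6), of t] assms(5) by simp
  moreover have "f z - f (X t) \<ge> - ((X t - z) \<bullet> grad f (X t))"
    using convex_on_above_gradient_tangent[OF assms(2) GDERIV_grad, of "X t" z] assms(1)
    by (simp add: differentiable_on_eq_differentiable_at inner_diff_left)
  ultimately show "f (X t) - f z \<le> 2 / 3 * (f X0 - f z)
      - 1 / 6 * (deriv ^^ 2) (\<lambda>\<tau>. (norm (X \<tau> - z))\<^sup>2) t"
    by argo
qed

end
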